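(* Let $G$ be a finite non-abelian group, $H$ a subgroup of $G$ with $H \neq Z(H,G)$, and $g \in K(H,G)$. If $g$ is a non-central element of $G$ such that $g \in H$ and $g^2 = 1$, then $\operatorname{diam}(\Delta_{H,G}^g) = 2$.
   Context: For a subgroup $H$ of a finite non-abelian group $G$, write $[x,y] = x^{-1}y^{-1}xy$, $Z(H,G) = \{x \in H : xy = yx \text{ for all } y \in G\}$ and $K(H,G) = \{[x,y] : x \in H,\ y \in G\}$. For $g \in G$, $\Delta_{H,G}^g$ is the simple graph with vertex set $G \setminus Z(H,G)$ in which two distinct vertices $x,y$ are adjacent if and only if ($x \in H$ or $y \in H$) and $[x,y] \neq g$ and $[x,y] \neq g^{-1}$. $\operatorname{diam}$ denotes the diameter of a graph. *)

theory Defs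
  imports "HOL-Algebra.Group" "Graph_Theory.Graph_Theory"
begin

definition commutator :: "('a, 'b) monoid_scheme \<Rightarrow> 'a \<Rightarrow> 'a \<Rightarrow> 'a" where
  "commutator G x y = inv\<^bsub>G\<^esub> x \<otimes>\<^bsub>G\<^esub> inv\<^bsub>G\<^esub> y \<otimes>\<^bsub>G\<^esub> x \<otimes>\<^bsub>G\<^esub> y"

(* Z(H,G); the centre of G itself is Z(G,G) = relative_centre G (carrier G). *)
definition relative_centre :: "('a, 'b) monoid_scheme \<Rightarrow> 'a set \<Rightarrow> 'a set" where
  "relative_centre G H = {x \<in> H. \<forall>y \<in> carrier G. x \<otimes>\<^bsub>G\<^esub> y = y \<otimes>\<^bsub>G\<^esub> x}"

(* K(H,G): the set of commutators, not the subgroup it generates. *)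
definition relative_commutators :: "('a, 'b) monoid_scheme \<Rightarrow> 'a set \<Rightarrow> 'a set" where
  "relative_commutators G H = {commutator G x y | x y. x \<in> H \<and> y \<in> carrier G}"

(* The simple graph Delta^g_{H,G}, as a symmetric loop-free digraph: an edge {x, y} is
   represented by the two arcs (x, y) and (y, x); see pair_graph_delta_graph below. *)
definition delta_graph :: "('a, 'b) monoid_scheme \<Rightarrow> 'a set \<Rightarrow> 'a \<Rightarrow> 'a pair_pre_digraph" where
  "delta_graph G H g =
     \<lparr> pverts = carrier G - relative_centre G H,
       parcs = {(x, y). x \<in> carrier G - relative_centre G H \<and>
                        y \<in> carrier G - relative_centre G H \<and>
                        x \<noteq> y \<and> (x \<in> H \<or> y \<in> H) \<and>
                        commutator G x y \<noteq> g \<and> commutator G x y \<noteq> inv\<^bsub>G\<^esub> g} \<rparr>"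

(* \<mu> with unit weights is the usual distance: the least number of arcs of a walk from u to v,
   and \<infinity> if there is none.  The diameter is \<infinity> for a disconnected graph and, as the
   supremum of the empty set, -\<infinity> for a graph without vertices. *)
definition (in wf_digraph) diameter :: ereal where
  "diameter = (SUP u \<in> verts G. SUP v \<in> verts G. \<mu> (\<lambda>_. 1) u v)"

lemma (in group) commutator_swap:
  assumes "x \<in> carrier G" "y \<in> carrier G"
  shows "commutator G y x = inv (commutator G x y)"
  using assms by (simp add: commutator_def inv_mult_group m_assoc)

lemma wf_digraph_delta_graph: "wf_digraph (with_proj (delta_graph G H g))"
  by unfold_locales (auto simp: delta_graph_def)

lemma (in group) pair_graph_delta_graph:
  assumes "finite (carrier G)" "g \<in> carrier G"
  shows "pair_graph (delta_graph G H g)"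
proof
  let ?V = "carrier G - relative_centre G H"
  have "parcs (delta_graph G H g) \<subseteq> ?V \<times> ?V"
    by (auto simp: delta_graph_def)
  moreover have "finite ?V" using assms(1) by simp
  ultimately show "finite (parcs (delta_graph G H g))"
    by (meson finite_SigmaI finite_subset)
  have "(y, x) \<in> parcs (delta_graph G H g)" if "(x, y) \<in> parcs (delta_graph G H g)" for x y
  proof -
    have xy: "x \<in> carrier G" "y \<in> carrier G"
      using that by (auto simp: delta_graph_def)
    then have "commutator G x y \<in> carrier G" by (simp add: commutator_def)
    with that show ?thesis
      using commutator_swap[OF xy] assms(2)
      by (auto simp: delta_graph_def dest: inv_inv)
  qed
  then show "symmetric (with_proj (delta_graph G H g))"
    by (auto simp: symmetric_def intro!: symI)
qed (use assms in \<open>auto simp: delta_graph_def\<close>)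

end

theory Submission
  imports Defs
begin

text \<open>
  The vertex \<open>g\<close> itself is a hub.  Since \<open>g = g\<inverse>\<close>, an equation \<open>[g, x] = g\<close> reads
  \<open>g (x\<inverse> g x) = g\<close>; it would make the conjugate \<open>x\<inverse> g x\<close> trivial and hence \<open>g = 1\<close>, which is
  central.  As \<open>g\<close> lies in \<open>H\<close>, it is therefore adjacent to every other vertex, and any two
  vertices are joined by a walk of length at most two through \<open>g\<close>.

  On the other hand \<open>g = [x, y]\<close> for some \<open>x \<in> H\<close> and \<open>y \<in> G\<close>.  This commutator is nontrivial, so
  \<open>x\<close> and \<open>y\<close> are distinct vertices, and they are not adjacent because their commutator is the
  forbidden value.  So distance two is attained.  The lemma \<open>diameter_eq_two\<close> is this pattern for
  arbitrary digraphs: a hub together with one non-adjacent pair.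
\<close>

lemma (in wf_digraph) two_le_unit_distance:
  assumes "u \<noteq> v" and "\<not> u \<rightarrow> v"
  shows "2 \<le> \<mu> (\<lambda>_. 1) u v"
  unfolding \<mu>_def
proof (rule INF_greatest)
  fix p assume "p \<in> {p. awalk u p v}"
  then have walk: "awalk u p v" by simp
  have "2 \<le> length p"
  proof (rule ccontr)
    assume "\<not> 2 \<le> length p"
    then consider "p = []" | e where "p = [e]"
      by (cases p; cases "tl p") auto
    then show False
      using walk assms by cases (auto simp: awalk_Nil_iff awalk_Cons_iff arcs_ends_def arc_to_ends_def)
  qed
  then show "2 \<le> ereal (awalk_cost (\<lambda>_. 1) p)"
    by (simp add: awalk_cost_def sum_list_triv numeral_eq_ereal)
qed

lemma (in wf_digraph) unit_distance_le_two_via_hub: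
  assumes "u \<in> verts G" and "v \<in> verts G"
    and from_hub: "\<And>w. w \<in> verts G \<Longrightarrow> w \<noteq> c \<Longrightarrow> c \<rightarrow> w"
    and to_hub: "\<And>w. w \<in> verts G \<Longrightarrow> w \<noteq> c \<Longrightarrow> w \<rightarrow> c"
  shows "\<mu> (\<lambda>_. 1) u v \<le> 2"
proof -
  have reach: "\<exists>p. awalk a p b \<and> length p \<le> 1"
    if "a \<in> verts G" "b \<in> verts G" "a = b \<or> a \<rightarrow> b" for a b
  proof (cases "a = b")
    case True
    with that show ?thesis by (intro exI[of _ "[]"]) (simp add: awalk_Nil_iff)
  next
    case False
    with that obtain e where "arc e (a, b)" by (auto simp: arc_def)
    with that show ?thesis
      by (intro exI[of _ "[e]"]) (auto simp: awalk_Nil_iff awalk_Cons_iff arc_def)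
  qed
  \<comment> \<open>That \<open>c\<close> is a vertex follows from the arcs at \<open>c\<close> unless \<open>u = c\<close>, where it is given.\<close>
  have c: "c \<in> verts G"
    using assms(1) to_hub[of u] by (cases "u = c") (auto dest: adj_in_verts)
  obtain p q where "awalk u p c" "length p \<le> 1" "awalk c q v" "length q \<le> 1"
    using reach[OF assms(1) c] reach[OF c assms(2)] from_hub to_hub assms(1,2) by metis
  then have "awalk u (p @ q) v" "length (p @ q) \<le> 2" by auto
  then have "\<mu> (\<lambda>_. 1) u v \<le> ereal (length (p @ q))"
    using min_cost_le_walk_cost[of u "p @ q" v "\<lambda>_. 1"]
    by (simp add: awalk_cost_def sum_list_triv)
  also have "\<dots> \<le> 2"
    using \<open>length (p @ q) \<le> 2\<close> by (simp add: numeral_eq_ereal)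
  finally show ?thesis .
qed

lemma (in wf_digraph) diameter_eq_two:
  assumes "\<And>w. w \<in> verts G \<Longrightarrow> w \<noteq> c \<Longrightarrow> c \<rightarrow> w"
    and "\<And>w. w \<in> verts G \<Longrightarrow> w \<noteq> c \<Longrightarrow> w \<rightarrow> c"
    and "x \<in> verts G" and "y \<in> verts G" and "x \<noteq> y" and "\<not> x \<rightarrow> y"
  shows "diameter = 2"
proof (rule antisym)
  show "diameter \<le> 2"
    unfolding diameter_def
    using unit_distance_le_two_via_hub[OF _ _ assms(1,2)] by (intro SUP_least)
  have "2 \<le> \<mu> (\<lambda>_. 1) x y"
    using assms(5,6) by (rule two_le_unit_distance)
  also have "\<dots> \<le> diameter"
    unfolding diameter_def
    by (intro SUP_upper2[OF assms(3)] SUP_upper2[OF assms(4)] order_refl)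
  finally show "2 \<le> diameter" .
qed

lemma (in group) commutator_eq_one_iff:
  assumes "x \<in> carrier G" and "y \<in> carrier G"
  shows "commutator G x y = \<one> \<longleftrightarrow> x \<otimes> y = y \<otimes> x"
proof -
  have "commutator G x y = inv (y \<otimes> x) \<otimes> (x \<otimes> y)"
    using assms by (simp add: commutator_def inv_mult_group m_assoc)
  then show ?thesis
    using assms by (metis inv_closed inv_equality inv_inv l_inv m_closed)
qed

text \<open>
  For an involution \<open>g\<close>, \<open>[g, x]\<close> is the product of \<open>g\<close> with a conjugate of \<open>g\<close>; cancelling \<open>g\<close>
  makes that conjugate trivial.
\<close>

lemma (in group) involution_ne_own_commutator:
  assumes g: "g \<in> carrier G" and x: "x \<in> carrier G"
    and inv_g: "inv g = g" and "g \<noteq> \<one>"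
  shows "commutator G g x \<noteq> g"
proof
  assume "commutator G g x = g"
  then have "g \<otimes> (inv x \<otimes> (g \<otimes> x)) = g"
    using g x inv_g by (simp add: commutator_def m_assoc)
  then have "inv x \<otimes> (g \<otimes> x) = \<one>"
    using g x l_cancel_one[OF g, of "inv x \<otimes> (g \<otimes> x)"] by simp
  then have "g \<otimes> x = x"
    using g x by (metis inv_closed inv_equality inv_inv m_closed inv_solve_left r_one one_closed)
  then show False
    using g x \<open>g \<noteq> \<one>\<close> by simp
qed

theorem theorem3p1:
  fixes G :: "('a, 'b) monoid_scheme" and H :: "'a set" and g :: 'a
  assumes "group G"
    and "finite (carrier G)"
    and "\<not> comm_group G"
    and "subgroup H G"
    and "H \<noteq> relative_centre G H"
    and "g \<in> relative_commutators G H"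
    and "g \<notin> relative_centre G (carrier G)"
    and "g \<in> H"
    and "g [^]\<^bsub>G\<^esub> (2::nat) = \<one>\<^bsub>G\<^esub>"
  shows "wf_digraph.diameter (with_proj (delta_graph G H g)) = 2"
proof -
  interpret group G by fact
  interpret \<Delta>: wf_digraph "with_proj (delta_graph G H g)"
    by (rule wf_digraph_delta_graph)
  have H: "H \<subseteq> carrier G"
    using assms(4) by (rule subgroup.subset)
  with assms(8) have g: "g \<in> carrier G" by blast
  have g_vert: "g \<notin> relative_centre G H"
    using assms(7) g by (auto simp: relative_centre_def)
  have g_ne: "g \<noteq> \<one>\<^bsub>G\<^esub>"
    using assms(7) by (auto simp: relative_centre_def)
  have inv_g: "inv\<^bsub>G\<^esub> g = g"
    using assms(9) g by (intro inv_equality) (auto simp: numeral_2_eq_2)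

  have from_g: "commutator G g w \<noteq> g" if "w \<in> carrier G" for w
    using g that inv_g g_ne by (rule involution_ne_own_commutator)
  have to_g: "commutator G w g \<noteq> g" if "w \<in> carrier G" for w
    using from_g[OF that] commutator_swap[OF g that] inv_g g that
    by (metis commutator_def inv_closed inv_inv m_closed)

  obtain x y where x: "x \<in> H" and y: "y \<in> carrier G" and g_xy: "g = commutator G x y"
    using assms(6) by (auto simp: relative_commutators_def)
  have x': "x \<in> carrier G" using x H by blast
  have "x \<otimes>\<^bsub>G\<^esub> y \<noteq> y \<otimes>\<^bsub>G\<^esub> x"
    using g_ne commutator_eq_one_iff[OF x' y] g_xy by simp
  then have xy: "x \<noteq> y" "x \<notin> relative_centre G H" "y \<notin> relative_centre G H"
    using x' y unfolding relative_centre_def by (fastforce, blast, metis (mono_tags, lifting) mem_Collect_eq)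

  show ?thesis
  proof (rule \<Delta>.diameter_eq_two[where c = g and x = x and y = y])
    fix w assume "w \<in> verts (with_proj (delta_graph G H g))" "w \<noteq> g"
    then show "g \<rightarrow>\<^bsub>with_proj (delta_graph G H g)\<^esub> w"
      and "w \<rightarrow>\<^bsub>with_proj (delta_graph G H g)\<^esub> g"
      using g g_vert assms(8) from_g to_g inv_g by (auto simp: delta_graph_def)
  qed (use x' y xy g_xy in \<open>auto simp: delta_graph_def\<close>)
qed

end
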